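(* Let $H$ and $K$ be finite dimensional complex Hilbert spaces with $\dim(K)<2\dim(H)$ and $\dim(H)\ge 2$. Then every additive mapping $A:H\to K$ preserving orthogonality is complex-linear or conjugate-linear.
   Context: All dimensions are complex dimensions. A mapping $A:H\to K$ is additive if $A(x+y)=A(x)+A(y)$ for all $x,y\in H$. It preserves orthogonality if $\langle x|y\rangle=0$ in $H$ implies $\langle A(x)|A(y)\rangle=0$ in $K$, for all $x,y\in H$. *)

theory Defs
  imports "HOL-Analysis.Analysis"
begin

class scaleC = scaleR +
  fixes scaleC :: "complex \<Rightarrow> 'a \<Rightarrow> 'a"  (infixr \<open>*\<^sub>C\<close> 75)
  assumes scaleR_scaleC: "scaleR r x = scaleC (complex_of_real r) x"

class complex_vector = scaleC + ab_group_add +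
  assumes scaleC_add_right: "a *\<^sub>C (x + y) = a *\<^sub>C x + a *\<^sub>C y"
    and scaleC_add_left: "(a + b) *\<^sub>C x = a *\<^sub>C x + b *\<^sub>C x"
    and scaleC_scaleC: "a *\<^sub>C b *\<^sub>C x = (a * b) *\<^sub>C x"
    and scaleC_one: "1 *\<^sub>C x = x"

subclass (in complex_vector) real_vector
  by standard (simp_all add: scaleR_scaleC scaleC_add_right scaleC_add_left scaleC_scaleC scaleC_one)

global_interpretation complex_vector:
  vector_space "scaleC :: complex \<Rightarrow> 'a \<Rightarrow> 'a::complex_vector"
  defines cspan = complex_vector.span
    and cdim = complex_vector.dim
  by standard (simp_all add: scaleC_add_right scaleC_add_left scaleC_scaleC scaleC_one)

text \<open>
  The inner product is conjugate-linear in its first argument and linear in its second.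
  The real inner product of the superclass is its real part, so the norm is
  \<open>sqrt (Re (cinner x x))\<close>. Positive definiteness is inherited from there:
  \<open>cinner x x\<close> is real by \<open>cinner_commute\<close>.
\<close>

class complex_inner = complex_vector + real_inner +
  fixes cinner :: "'a \<Rightarrow> 'a \<Rightarrow> complex"
  assumes cinner_commute: "cinner x y = cnj (cinner y x)"
    and cinner_add_right: "cinner x (y + z) = cinner x y + cinner x z"
    and cinner_scaleC_right: "cinner x (c *\<^sub>C y) = c * cinner x y"
    and inner_eq_Re_cinner: "inner x y = Re (cinner x y)"

class complex_hilbert_space = complex_inner + complete_space

text \<open>
  \<open>cdim\<close> is \<open>0\<close> on infinite dimensional spaces, so finiteness of the dimension
  has to be required separately.
\<close>

definition cfinite_dimensional :: "'a::complex_vector set \<Rightarrow> bool" where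
  "cfinite_dimensional S \<longleftrightarrow> (\<exists>B. finite B \<and> cspan B = S)"

abbreviation complex_linear :: "('a::complex_vector \<Rightarrow> 'b::complex_vector) \<Rightarrow> bool" where
  "complex_linear \<equiv> Vector_Spaces.linear scaleC scaleC"

definition conjugate_linear :: "('a::complex_vector \<Rightarrow> 'b::complex_vector) \<Rightarrow> bool" where
  "conjugate_linear A \<longleftrightarrow> Modules.additive A \<and> (\<forall>c x. A (c *\<^sub>C x) = cnj c *\<^sub>C A x)"

definition preserves_orthogonality ::
    "('a::complex_inner \<Rightarrow> 'b::complex_inner) \<Rightarrow> bool" where
  "preserves_orthogonality A \<longleftrightarrow> (\<forall>x y. cinner x y = 0 \<longrightarrow> cinner (A x) (A y) = 0)"

end

theory Submission
  imports Defs
begin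

text \<open>
  Two orthonormal vectors \<open>x\<close> and \<open>y\<close> are enough to make the inner products of images rigid:
  \<open>x + c y\<close> is orthogonal to \<open>t y - cnj c t x\<close>, and expanding the orthogonality of the images
  gives \<open>\<langle>A (c y), A (t y)\<rangle> = \<langle>A x, A (cnj c t x)\<rangle>\<close>
  (\<open>cinner_image_transfer\<close>). Running this over an orthonormal basis of \<open>H\<close>, which has at least two
  elements, yields one additive function \<open>f\<close> on the complex numbers with
  \<open>\<langle>A x, A y\<rangle> = f \<langle>x, y\<rangle>\<close> for all \<open>x\<close> and \<open>y\<close> (\<open>cinner_image_factorization\<close>).

  Additivity alone would admit wild solutions of Cauchy's functional equation, but \<open>f\<close> is
  nonnegative on nonnegative reals because \<open>f (norm x ^ 2)\<close> is the squared norm of \<open>A x\<close>. Hence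
  \<open>f r = lam r\<close> for real \<open>r\<close>, so \<open>A\<close> scales norms by \<open>sqrt lam\<close>; being bounded
  and additive, it is real-linear. Then \<open>f\<close> is real-linear too, and it commutes with conjugation,
  so \<open>f s = lam Re s + \<i> mu Im s\<close> with real \<open>lam\<close> and \<open>mu\<close> (\<open>cinner_image_form\<close>).

  Now split \<open>2 A = P + Q\<close> with \<open>P x = A x - \<i> A (\<i> x)\<close> complex-linear and
  \<open>Q x = A x + \<i> A (\<i> x)\<close> conjugate-linear. The formula for \<open>f\<close> makes the ranges of \<open>P\<close> and \<open>Q\<close>
  orthogonal, and \<open>P\<close> and \<open>Q\<close> multiply the inner product, up to conjugation, by
  \<open>2 (lam + mu)\<close> and \<open>2 (lam - mu)\<close>. If both factors were nonzero, an orthonormal basis of \<open>H\<close> would be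
  mapped by \<open>P\<close> and \<open>Q\<close> to \<open>2 dim H\<close> nonzero orthogonal vectors of \<open>K\<close>, which is too many.
  So \<open>P = 0\<close> or \<open>Q = 0\<close>.
\<close>

section \<open>Complex inner products\<close>

lemma cinner_add_left: "cinner (x + y) z = cinner x z + cinner y (z::'a::complex_inner)"
  by (metis cinner_add_right cinner_commute complex_cnj_add)

lemma cinner_scaleC_left: "cinner (c *\<^sub>C x) y = cnj c * cinner x (y::'a::complex_inner)"
  by (metis cinner_commute cinner_scaleC_right complex_cnj_mult)

lemma additive_cinner_right: "Modules.additive (cinner (x::'a::complex_inner))"
  by (simp add: Modules.additive_def cinner_add_right)

lemma additive_cinner_left: "Modules.additive (\<lambda>x. cinner x (y::'a::complex_inner))"
  by (simp add: Modules.additive_def cinner_add_left)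

lemmas cinner_zero_right [simp] = additive.zero [OF additive_cinner_right]
  and cinner_diff_right = additive.diff [OF additive_cinner_right]
  and cinner_diff_left = additive.diff [OF additive_cinner_left]
  and cinner_sum_right = additive.sum [OF additive_cinner_right]
  and cinner_sum_left = additive.sum [OF additive_cinner_left]

lemma cinner_self: "cinner x x = complex_of_real ((norm (x::'a::complex_inner))\<^sup>2)"
proof (rule complex_eqI)
  show "Re (cinner x x) = Re (complex_of_real ((norm x)\<^sup>2))"
    by (simp add: power2_norm_eq_inner inner_eq_Re_cinner)
  have "Im (cinner x x) = - Im (cinner x x)"
    by (subst cinner_commute) simp
  then show "Im (cinner x x) = Im (complex_of_real ((norm x)\<^sup>2))" by simp
qed

lemma cinner_self_eq_zero_iff [simp]: "cinner x x = 0 \<longleftrightarrow> x = (0::'a::complex_inner)"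
  by (simp add: cinner_self)

section \<open>Orthogonal sets and orthonormal bases\<close>

text \<open>
  Pairing a vanishing combination with one of its vectors isolates the coefficient of that vector.
\<close>

lemma independent_if_orthogonal:
  fixes T :: "'a::complex_inner set"
  assumes orth: "pairwise (\<lambda>x y. cinner x y = 0) T" and "0 \<notin> T"
  shows "complex_vector.independent T"
proof
  assume "complex_vector.dependent T"
  then obtain U u v where U: "finite U" "U \<subseteq> T" "(\<Sum>w\<in>U. u w *\<^sub>C w) = 0" "v \<in> U" "u v \<noteq> 0"
    unfolding complex_vector.dependent_explicit by blast
  have "0 = cinner v (\<Sum>w\<in>U. u w *\<^sub>C w)" using U(3) by simp
  also have "\<dots> = (\<Sum>w\<in>U. if w = v then u v * cinner v v else 0)"
    unfolding cinner_sum_right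
    by (rule sum.cong) (use orth U in \<open>auto simp: cinner_scaleC_right dest: pairwiseD\<close>)
  also have "\<dots> = u v * cinner v v" using U by simp
  finally show False using U assms(2) by auto
qed

lemma orthogonal_card_le_cdim:
  fixes T :: "'a::complex_inner set"
  assumes "cfinite_dimensional (UNIV :: 'a set)"
    and "pairwise (\<lambda>x y. cinner x y = 0) T" and "0 \<notin> T"
  shows "finite T" and "card T \<le> cdim (UNIV :: 'a set)"
proof -
  obtain B0 :: "'a set" where B0: "finite B0" "cspan B0 = UNIV"
    using assms(1) by (auto simp: cfinite_dimensional_def)
  obtain B :: "'a set" where B: "complex_vector.independent B" "UNIV \<subseteq> cspan B"
      "card B = cdim (UNIV :: 'a set)"
    using complex_vector.basis_exists[of UNIV] by auto
  have "finite B"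
    using complex_vector.independent_span_bound[OF B0(1) B(1)] B0(2) by auto
  then have "finite T \<and> card T \<le> card B"
    by (intro complex_vector.independent_span_bound independent_if_orthogonal assms) (use B in auto)
  then show "finite T" "card T \<le> cdim (UNIV :: 'a set)" using B(3) by auto
qed

definition orthonormal :: "'a::complex_inner set \<Rightarrow> bool" where
  "orthonormal S \<longleftrightarrow> (\<forall>d\<in>S. \<forall>e\<in>S. cinner d e = (if d = e then 1 else 0))"

lemma orthonormal_imp_orthogonal:
  assumes "orthonormal S"
  shows "pairwise (\<lambda>x y. cinner x y = 0) S" and "0 \<notin> S"
proof -
  show "pairwise (\<lambda>x y. cinner x y = 0) S"
    using assms by (auto simp: orthonormal_def pairwise_def)
  show "0 \<notin> S"
    using assms by (force simp: orthonormal_def)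
qed

text \<open>
  The dimension bounds the size of orthonormal sets, so there is one of maximal cardinality. It must
  span: the normalized remainder of a vector outside its span would enlarge it.
\<close>

lemma orthonormal_basis_exists:
  assumes fin: "cfinite_dimensional (UNIV :: 'a::complex_inner set)"
  obtains S :: "'a::complex_inner set"
  where "finite S" "orthonormal S" "card S = cdim (UNIV :: 'a set)"
    "\<And>x. x = (\<Sum>e\<in>S. cinner e x *\<^sub>C e)"
proof -
  have bound: "finite S" "card S \<le> cdim (UNIV :: 'a set)" if "orthonormal S" for S :: "'a set"
    using orthogonal_card_le_cdim[OF fin orthonormal_imp_orthogonal[OF that]] by auto
  have empty: "orthonormal ({} :: 'a set)" by (simp add: orthonormal_def)
  have "\<forall>S :: 'a set. orthonormal S \<longrightarrow> card S < Suc (cdim (UNIV :: 'a set))"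
    using bound(2) by (simp add: less_Suc_eq_le)
  from ex_has_greatest_nat[where P = orthonormal and f = card, OF empty this]
  obtain S :: "'a set" where S: "orthonormal S"
    and max: "\<And>T :: 'a set. orthonormal T \<Longrightarrow> card T \<le> card S"
    by blast
  note finS = bound(1)[OF S]
  have expand: "x = (\<Sum>e\<in>S. cinner e x *\<^sub>C e)" for x
  proof (rule ccontr)
    define r where "r = x - (\<Sum>e\<in>S. cinner e x *\<^sub>C e)"
    assume "x \<noteq> (\<Sum>e\<in>S. cinner e x *\<^sub>C e)"
    then have r0: "r \<noteq> 0" by (simp add: r_def)
    have perp: "cinner d r = 0" if "d \<in> S" for d
    proof -
      have "(\<Sum>e\<in>S. cinner d (cinner e x *\<^sub>C e)) = (\<Sum>e\<in>S. if e = d then cinner d x else 0)"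
        by (rule sum.cong) (use S that in \<open>auto simp: orthonormal_def cinner_scaleC_right\<close>)
      then show ?thesis using that finS by (simp add: r_def cinner_diff_right cinner_sum_right)
    qed
    define q where "q = complex_of_real (1 / norm r) *\<^sub>C r"
    have q1: "cinner q q = 1"
    proof -
      have "cinner q q = complex_of_real (1 / norm r) * complex_of_real (1 / norm r) * cinner r r"
        by (simp add: q_def cinner_scaleC_left cinner_scaleC_right)
      also have "\<dots> = 1"
        using r0 unfolding cinner_self by (simp add: power2_eq_square)
      finally show ?thesis .
    qed
    have q2: "cinner d q = 0 \<and> cinner q d = 0" if "d \<in> S" for d
      using perp[OF that] cinner_commute[of r d]
      by (simp add: q_def cinner_scaleC_left cinner_scaleC_right)
    have "q \<notin> S" using q1 q2 by force
    have "orthonormal (insert q S)"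
      using S q1 q2 by (auto simp: orthonormal_def)
    from max[OF this] \<open>q \<notin> S\<close> finS show False by simp
  qed
  have "x \<in> cspan S" for x
    by (subst expand[of x]) (intro complex_vector.span_sum complex_vector.span_scale
        complex_vector.span_base)
  then have "card S = cdim (UNIV :: 'a set)"
    by (intro complex_vector.dim_eq_card[symmetric])
      (use independent_if_orthogonal[OF orthonormal_imp_orthogonal[OF S]] in auto)
  with S finS expand show thesis using that by blast
qed

section \<open>Additive functions of a real variable\<close>

lemma additive_of_nat_scale:
  fixes g :: "real \<Rightarrow> 'a::real_vector"
  assumes "Modules.additive g"
  shows "g (real n * r) = real n *\<^sub>R g r"
  by (induction n)
    (simp_all add: additive.zero[OF assms] additive.add[OF assms] scaleR_add_left distrib_right)

text \<open>
  Subtracting the linear function with the same value at 1 leaves an additive function that vanishes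
  on the integers. It has period 1, so its bound on the unit interval holds everywhere; a bounded
  additive function is zero, as its values at the multiples of an argument grow linearly.
\<close>

lemma additive_bounded_imp_homogeneous:
  fixes g :: "real \<Rightarrow> 'a::real_normed_vector"
  assumes add: "Modules.additive g"
    and bdd: "\<And>r. 0 \<le> r \<Longrightarrow> r \<le> 1 \<Longrightarrow> norm (g r) \<le> M"
  shows "g r = r *\<^sub>R g 1"
proof -
  define h where "h r = g r - r *\<^sub>R g 1" for r
  have h: "Modules.additive h"
    by (simp add: Modules.additive_def h_def additive.add[OF add] scaleR_add_left)
  have h1: "h 1 = 0" by (simp add: h_def)
  have h_of_nat: "h (real n) = 0" for n
    using additive_of_nat_scale[OF h, of n 1] h1 by simp
  have h_of_int: "h (of_int k) = 0" for k
    by (cases k rule: int_cases2) (simp_all add: additive.minus[OF h] h_of_nat)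
  have h_bdd: "norm (h r) \<le> 2 * M" for r
  proof -
    have "h r = h (frac r)"
      by (simp add: frac_def additive.diff[OF h] h_of_int)
    also have "norm \<dots> \<le> norm (g (frac r)) + norm (frac r *\<^sub>R g 1)"
      unfolding h_def by (rule norm_triangle_ineq4)
    also have "norm (g (frac r)) \<le> M"
      by (rule bdd) (simp_all add: frac_ge_0 less_imp_le[OF frac_lt_1])
    also have "norm (frac r *\<^sub>R g 1) \<le> 1 * M"
      unfolding norm_scaleR
      by (intro mult_mono bdd) (simp_all add: frac_ge_0 less_imp_le[OF frac_lt_1])
    finally show ?thesis by simp
  qed
  have "norm (h r) = 0"
  proof (rule ccontr)
    assume "norm (h r) \<noteq> 0"
    then have "norm (h r) > 0" by simp
    then obtain n where "2 * M < real n * norm (h r)"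
      using reals_Archimedean3 by blast
    moreover have "real n * norm (h r) = norm (h (real n * r))"
      by (simp add: additive_of_nat_scale[OF h])
    ultimately show False using h_bdd[of "real n * r"] by linarith
  qed
  then show ?thesis by (simp add: h_def)
qed

section \<open>The form of the inner products of images\<close>

text \<open>
  This frees the inner products of images on a complex line from the choice of the line: the right
  side mentions \<open>x\<close> only, and \<open>cnj c * t\<close> is the inner product of the two arguments on the left.
\<close>

lemma cinner_image_transfer:
  fixes A :: "'h::complex_inner \<Rightarrow> 'k::complex_inner"
  assumes add: "Modules.additive A" and orth: "preserves_orthogonality A"
    and xy: "cinner x x = 1" "cinner y y = 1" "cinner x y = 0"
  shows "cinner (A (c *\<^sub>C y)) (A (t *\<^sub>C y)) = cinner (A x) (A ((cnj c * t) *\<^sub>C x))"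
proof -
  have yx: "cinner y x = 0" using xy(3) cinner_commute[of y x] by simp
  have pres: "cinner (A u) (A v) = 0" if "cinner u v = 0" for u v
    using orth that by (auto simp: preserves_orthogonality_def)
  \<comment> \<open>Among the four terms of this product the mixed ones vanish and the other two cancel.\<close>
  have "cinner (x + c *\<^sub>C y) (t *\<^sub>C y - (cnj c * t) *\<^sub>C x) = 0"
    by (simp add: cinner_add_left cinner_diff_right cinner_scaleC_left cinner_scaleC_right xy yx)
  from pres[OF this]
  have "cinner (A x + A (c *\<^sub>C y)) (A (t *\<^sub>C y) - A ((cnj c * t) *\<^sub>C x)) = 0"
    by (simp add: additive.add[OF add] additive.diff[OF add])
  moreover have "cinner (A x) (A (t *\<^sub>C y)) = 0" "cinner (A (c *\<^sub>C y)) (A ((cnj c * t) *\<^sub>C x)) = 0"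
    by (rule pres; simp add: cinner_scaleC_left cinner_scaleC_right xy yx)+
  ultimately show ?thesis
    by (simp add: cinner_add_left cinner_diff_right)
qed

text \<open>
  Expand both arguments in an orthonormal basis. Mixed terms vanish since \<open>A\<close> preserves
  orthogonality, and the transfer identity evaluates every diagonal term by the same function.
\<close>

lemma cinner_image_factorization:
  fixes A :: "'h::complex_inner \<Rightarrow> 'k::complex_inner"
  assumes fin: "cfinite_dimensional (UNIV :: 'h set)" and dim: "cdim (UNIV :: 'h set) \<ge> 2"
    and add: "Modules.additive A" and orth: "preserves_orthogonality A"
  obtains f where "Modules.additive f" "\<And>x y. cinner (A x) (A y) = f (cinner x y)"
proof -
  obtain S :: "'h set" where S: "finite S" "orthonormal S" "card S = cdim (UNIV :: 'h set)"
    and expand: "\<And>x. x = (\<Sum>e\<in>S. cinner e x *\<^sub>C e)"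
    using orthonormal_basis_exists[OF fin] by blast
  have pres: "cinner (A u) (A v) = 0" if "cinner u v = 0" for u v
    using orth that by (auto simp: preserves_orthogonality_def)
  from S(1,3) dim obtain d d' where d: "d \<in> S" "d' \<in> S" "d \<noteq> d'"
    by (metis card_le_Suc0_iff_eq not_less_eq_eq numeral_2_eq_2)
  define f where "f c = cinner (A d) (A (c *\<^sub>C d))" for c
  have addf: "Modules.additive f"
    by (simp add: Modules.additive_def f_def scaleC_add_left additive.add[OF add] cinner_add_right)
  have transfer: "cinner (A (c *\<^sub>C y)) (A (t *\<^sub>C y)) = cinner (A x) (A ((cnj c * t) *\<^sub>C x))"
    if "x \<in> S" "y \<in> S" "x \<noteq> y" for x y c t
    by (rule cinner_image_transfer[OF add orth]) (use S(2) that in \<open>auto simp: orthonormal_def\<close>)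
  have diagonal: "cinner (A (c *\<^sub>C e)) (A (t *\<^sub>C e)) = f (cnj c * t)" if "e \<in> S" for e c t
  proof (cases "e = d")
    case False
    then show ?thesis unfolding f_def using transfer d that by metis
  next
    case True
    \<comment> \<open>At \<open>d\<close> itself, move to a second basis vector \<open>d'\<close> and back.\<close>
    have "cinner (A (c *\<^sub>C d)) (A (t *\<^sub>C d)) = cinner (A d') (A ((cnj c * t) *\<^sub>C d'))"
      using transfer d by metis
    also have "\<dots> = f (cnj c * t)"
      unfolding f_def using transfer[OF d, of 1 "cnj c * t"] by (simp add: scaleC_one)
    finally show ?thesis using True by simp
  qed
  have "cinner (A x) (A y) = f (cinner x y)" for x y
  proof -
    have A_expand: "A z = (\<Sum>e\<in>S. A (cinner e z *\<^sub>C e))" for z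
      using arg_cong[OF expand[of z], of A] by (simp only: additive.sum[OF add])
    have "cinner (A x) (A y)
        = (\<Sum>e\<in>S. \<Sum>e'\<in>S. cinner (A (cinner e x *\<^sub>C e)) (A (cinner e' y *\<^sub>C e')))"
      by (subst A_expand[of x], subst A_expand[of y], subst cinner_sum_left)
        (simp only: cinner_sum_right)
    also have "\<dots> = (\<Sum>e\<in>S. \<Sum>e'\<in>S. if e' = e then f (cinner x e * cinner e y) else 0)"
    proof (intro sum.cong refl)
      fix e e' assume e: "e \<in> S" "e' \<in> S"
      show "cinner (A (cinner e x *\<^sub>C e)) (A (cinner e' y *\<^sub>C e'))
          = (if e' = e then f (cinner x e * cinner e y) else 0)"
        using e S(2) diagonal[of e] cinner_commute[of x e]
        by (auto simp: orthonormal_def cinner_scaleC_left cinner_scaleC_right intro!: pres)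
    qed
    also have "\<dots> = f (\<Sum>e\<in>S. cinner x e * cinner e y)"
      using S(1) by (simp add: additive.sum[OF addf])
    also have "(\<Sum>e\<in>S. cinner x e * cinner e y) = cinner x (\<Sum>e\<in>S. cinner e y *\<^sub>C e)"
      by (simp add: cinner_sum_right cinner_scaleC_right mult.commute)
    also have "\<dots> = cinner x y" by (simp flip: expand)
    finally show ?thesis .
  qed
  with addf show thesis by (rule that)
qed

text \<open>
  Regularity enters only through positivity: \<open>f\<close> takes squared norms to squared norms, which bounds
  its real part between 0 and \<open>f 1\<close> on the unit interval. The boundedness of \<open>A\<close> that follows
  makes \<open>A\<close> real-homogeneous, and this settles \<open>f\<close> on the imaginary axis.
\<close>

lemma cinner_image_form:
  fixes A :: "'h::complex_inner \<Rightarrow> 'k::complex_inner"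
  assumes fin: "cfinite_dimensional (UNIV :: 'h set)" and dim: "cdim (UNIV :: 'h set) \<ge> 2"
    and add: "Modules.additive A" and orth: "preserves_orthogonality A"
  obtains lam mu :: real
  where "\<And>r x. A (complex_of_real r *\<^sub>C x) = complex_of_real r *\<^sub>C A x"
    "\<And>x y. cinner (A x) (A y) = Complex (lam * Re (cinner x y)) (mu * Im (cinner x y))"
proof -
  obtain f where addf: "Modules.additive f" and f: "\<And>x y. cinner (A x) (A y) = f (cinner x y)"
    using cinner_image_factorization[OF assms] by blast
  obtain S :: "'h set" where S: "orthonormal S" "card S = cdim (UNIV :: 'h set)"
    using orthonormal_basis_exists[OF fin] by blast
  from S(2) dim obtain v where "v \<in> S" by force
  with S(1) have v: "cinner v v = 1" by (simp add: orthonormal_def)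
  have f_cnj: "f (cnj c) = cnj (f c)" for c
    using f[of v "c *\<^sub>C v"] f[of "c *\<^sub>C v" v] cinner_commute[of "A (c *\<^sub>C v)" "A v"] v
    by (simp add: cinner_scaleC_left cinner_scaleC_right)
  have f_square: "f (complex_of_real ((norm x)\<^sup>2)) = complex_of_real ((norm (A x))\<^sup>2)" for x
    using f[of x x] by (simp add: cinner_self)
  define lam where "lam = Re (f 1)"
  have f_nonneg: "Re (f (complex_of_real r)) \<ge> 0" if "r \<ge> 0" for r
  proof -
    have "f (complex_of_real r)
        = cinner (A (complex_of_real (sqrt r) *\<^sub>C v)) (A (complex_of_real (sqrt r) *\<^sub>C v))"
      using that v by (simp add: f cinner_scaleC_left cinner_scaleC_right flip: of_real_mult)
    then show ?thesis by (simp add: cinner_self)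
  qed
  have f_real: "f (complex_of_real r) = complex_of_real (lam * r)" for r
  proof -
    have addg: "Modules.additive (\<lambda>r. Re (f (complex_of_real r)))"
      by (simp add: Modules.additive_def additive.add[OF addf])
    have "norm (Re (f (complex_of_real s))) \<le> lam" if "0 \<le> s" "s \<le> 1" for s
      using f_nonneg[of s] f_nonneg[of "1 - s"] additive.add[OF addg, of s "1 - s"] that
      by (simp add: lam_def)
    from additive_bounded_imp_homogeneous[OF addg this, of r]
    have "Re (f (complex_of_real r)) = lam * r" by (simp add: lam_def)
    moreover have "Im (f (complex_of_real r)) = 0"
      using f_cnj[of "complex_of_real r"] by (simp add: complex_eq_iff)
    ultimately show ?thesis by (simp add: complex_eq_iff)
  qed
  have norm_A: "(norm (A x))\<^sup>2 = lam * (norm x)\<^sup>2" for x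
    using f_square[of x] unfolding f_real of_real_eq_iff by simp
  have A_real: "A (complex_of_real r *\<^sub>C x) = complex_of_real r *\<^sub>C A x" for r x
  proof -
    have addg: "Modules.additive (\<lambda>r. A (r *\<^sub>R x))"
      by (simp add: Modules.additive_def additive.add[OF add] scaleR_add_left)
    have "norm (A (s *\<^sub>R x)) \<le> norm (A x)" if "0 \<le> s" "s \<le> 1" for s
    proof (rule power2_le_imp_le)
      have "(norm (A (s *\<^sub>R x)))\<^sup>2 = s\<^sup>2 * (norm (A x))\<^sup>2"
        by (simp add: norm_A power_mult_distrib)
      also have "\<dots> \<le> 1 * (norm (A x))\<^sup>2"
        using that by (intro mult_right_mono) (auto simp: power_le_one)
      finally show "(norm (A (s *\<^sub>R x)))\<^sup>2 \<le> (norm (A x))\<^sup>2" by simp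
    qed simp
    from additive_bounded_imp_homogeneous[OF addg this, of r]
    show ?thesis by (simp add: scaleR_scaleC scaleC_one)
  qed
  define mu where "mu = Im (f \<i>)"
  have f_imag: "f (complex_of_real r * \<i>) = Complex 0 (mu * r)" for r
  proof -
    have "f (complex_of_real r * \<i>) = cinner (A v) (A (complex_of_real r *\<^sub>C \<i> *\<^sub>C v))"
      by (simp add: f cinner_scaleC_right v)
    also have "\<dots> = complex_of_real r * f \<i>"
      unfolding A_real by (simp add: cinner_scaleC_right f v)
    also have "Re (f \<i>) = 0"
      using f_cnj[of \<i>] by (simp add: additive.minus[OF addf] complex_eq_iff)
    then have "f \<i> = Complex 0 mu" by (simp add: mu_def complex_eq_iff)
    finally show ?thesis by (simp add: complex_eq_iff mult.commute)
  qed
  have "f c = Complex (lam * Re c) (mu * Im c)" for c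
  proof -
    have "f c = f (complex_of_real (Re c)) + f (complex_of_real (Im c) * \<i>)"
      unfolding additive.add[OF addf, symmetric]
      by (rule arg_cong[where f = f]) (simp add: complex_eq_iff)
    then show ?thesis by (simp add: f_real f_imag complex_eq_iff)
  qed
  with A_real f show thesis by (intro that) auto
qed

section \<open>Linear and conjugate-linear parts\<close>

theorem corollary2p10:
  fixes A :: "'h::complex_hilbert_space \<Rightarrow> 'k::complex_hilbert_space"
  assumes "cfinite_dimensional (UNIV :: 'h set)"
    and "cfinite_dimensional (UNIV :: 'k set)"
    and "cdim (UNIV :: 'k set) < 2 * cdim (UNIV :: 'h set)"
    and "cdim (UNIV :: 'h set) \<ge> 2"
    and "Modules.additive A"
    and "preserves_orthogonality A"
  shows "complex_linear A \<or> conjugate_linear A"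
proof -
  obtain lam mu :: real where A_real: "\<And>r x. A (complex_of_real r *\<^sub>C x) = complex_of_real r *\<^sub>C A x"
    and form: "\<And>x y. cinner (A x) (A y) = Complex (lam * Re (cinner x y)) (mu * Im (cinner x y))"
    using cinner_image_form[OF assms(1,4-6)] by blast
  have A_complex: "A (c *\<^sub>C x)
      = complex_of_real (Re c) *\<^sub>C A x + complex_of_real (Im c) *\<^sub>C A (\<i> *\<^sub>C x)" for c x
  proof -
    have "c *\<^sub>C x = complex_of_real (Re c) *\<^sub>C x + complex_of_real (Im c) *\<^sub>C \<i> *\<^sub>C x"
      unfolding scaleC_scaleC scaleC_add_left[symmetric]
      by (rule arg_cong[where f = "\<lambda>c. c *\<^sub>C x"]) (simp add: complex_eq_iff)
    then show ?thesis by (simp only: additive.add[OF assms(5)] A_real)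
  qed
  \<comment> \<open>Twice the complex-linear and twice the conjugate-linear part of \<open>A\<close>.\<close>
  define P where "P x = A x - \<i> *\<^sub>C A (\<i> *\<^sub>C x)" for x
  define Q where "Q x = A x + \<i> *\<^sub>C A (\<i> *\<^sub>C x)" for x
  have PP: "cinner (P x) (P y) = complex_of_real (2 * (lam + mu)) * cinner x y" for x y
    by (simp add: P_def cinner_diff_left cinner_diff_right cinner_scaleC_left cinner_scaleC_right
        form complex_eq_iff algebra_simps)
  have QQ: "cinner (Q x) (Q y) = complex_of_real (2 * (lam - mu)) * cnj (cinner x y)" for x y
    by (simp add: Q_def cinner_add_left cinner_add_right cinner_scaleC_left cinner_scaleC_right
        form complex_eq_iff algebra_simps)
  have PQ: "cinner (P x) (Q y) = 0" for x y
    by (simp add: P_def Q_def cinner_diff_left cinner_add_right cinner_scaleC_left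
        cinner_scaleC_right form complex_eq_iff)
  have QP: "cinner (Q x) (P y) = 0" for x y
    using PQ[of y x] cinner_commute[of "Q x" "P y"] by simp
  have "lam + mu = 0 \<or> lam - mu = 0"
  proof (rule ccontr)
    assume nz: "\<not> ?thesis"
    \<comment> \<open>The images of a basis under both parts are then too many orthogonal vectors.\<close>
    obtain S :: "'h set" where S: "finite S" "orthonormal S" "card S = cdim (UNIV :: 'h set)"
      using orthonormal_basis_exists[OF assms(1)] by blast
    have on: "cinner d e = (if d = e then 1 else 0)" if "d \<in> S" "e \<in> S" for d e
      using S(2) that by (simp add: orthonormal_def)
    have Pnz: "P e \<noteq> 0" "Q e \<noteq> 0" if "e \<in> S" for e
      using PP[of e e] QQ[of e e] on[OF that that] nz
      by (auto simp del: of_real_add of_real_diff of_real_mult)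
    have "inj_on P S" "inj_on Q S"
      by (rule inj_onI, metis PP QQ Pnz on cinner_self_eq_zero_iff mult_zero_right
          complex_cnj_zero)+
    moreover have "P ` S \<inter> Q ` S = {}"
    proof -
      have "P d \<noteq> Q e" if "d \<in> S" for d e
        using PQ[of d e] Pnz(1)[OF that] by auto
      then show ?thesis by auto
    qed
    ultimately have "card (P ` S \<union> Q ` S) = 2 * card S"
      using S(1) by (simp add: card_Un_disjoint card_image)
    moreover have "card (P ` S \<union> Q ` S) \<le> cdim (UNIV :: 'k set)"
    proof (rule orthogonal_card_le_cdim(2)[OF assms(2)])
      show "pairwise (\<lambda>x y. cinner x y = 0) (P ` S \<union> Q ` S)"
        by (auto simp: pairwise_def PP QQ PQ QP on)
      show "0 \<notin> P ` S \<union> Q ` S" using Pnz by fastforce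
    qed
    ultimately show False using S(3) assms(3) by simp
  qed
  then show ?thesis
  proof
    assume "lam + mu = 0"
    then have "cinner (P x) (P x) = 0" for x by (simp only: PP) simp
    then have P0: "A x = \<i> *\<^sub>C A (\<i> *\<^sub>C x)" for x
      by (metis P_def cinner_self_eq_zero_iff right_minus_eq)
    have "A (\<i> *\<^sub>C x) = (- \<i>) *\<^sub>C A x" for x
      by (subst P0[of x]) (simp add: scaleC_scaleC scaleC_one)
    then have "A (c *\<^sub>C x) = cnj c *\<^sub>C A x" for c x
      by (simp only: A_complex[of c x] scaleC_scaleC scaleC_add_left[symmetric])
        (rule arg_cong[where f = "\<lambda>c. c *\<^sub>C A x"], simp add: complex_eq_iff)
    then show ?thesis using assms(5) by (simp add: conjugate_linear_def)
  next
    assume "lam - mu = 0"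
    then have "cinner (Q x) (Q x) = 0" for x by (simp only: QQ) simp
    then have Q0: "A x = - (\<i> *\<^sub>C A (\<i> *\<^sub>C x))" for x
      by (metis Q_def cinner_self_eq_zero_iff eq_neg_iff_add_eq_0)
    have "A (\<i> *\<^sub>C x) = \<i> *\<^sub>C A x" for x
      by (subst Q0[of x]) (simp add: scaleC_scaleC scaleC_one)
    then have "A (c *\<^sub>C x) = c *\<^sub>C A x" for c x
      by (simp only: A_complex[of c x] scaleC_scaleC scaleC_add_left[symmetric])
        (rule arg_cong[where f = "\<lambda>c. c *\<^sub>C A x"], simp add: complex_eq_iff)
    then have "complex_linear A"
      by unfold_locales (simp_all add: additive.add[OF assms(5)])
    then show ?thesis ..
  qed
qed

end
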